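(* Let $R$ be a nonassociative ring and let $(S,x)$ be a generalized nonassociative Ore extension (GNOE) of $R$ that satisfies the Euclidean division algorithm. If $R$ is Noetherian, then $S$ is Noetherian.
   Context: Conventions: $\mathbb{N}$ includes $0$; all rings are unital; a nonassociative ring is a ring that is not necessarily associative. A left (resp. right) module over a nonassociative ring $R$ is an abelian group $M$ with a biadditive map $R\times M\to M$ (resp. $M\times R\to M$) (no further axioms); a submodule is a subgroup closed under this multiplication; ${}_R\langle N\rangle$ (resp. $\langle N\rangle_R$) denotes the smallest left (resp. right) $R$-submodule containing $N$. A left (resp. right) $R$-module is free with basis $B$ if each element is uniquely a finite sum $\sum_{b\in B} r_b b$ (resp. $\sum_{b\in B} b r_b$) with $r_b\in R$. A module is Noetherian if each of its submodules is finitely generated; a ring is left (right) Noetherian if it is Noetherian as a left (right) module over itself, and Noetherian if it is both. Left GNOE of $R$: a pair $(S,x)$ such that (LG1) $S$ is a nonassociative ring containing $R$ as a (unital) subring, and $x\in S$; (LG2) $x$ is power-associative, i.e. the subring of $S$ generated by $x$ is associative; (LG3) $S$ is a free left $R$-module with basis $\{1,x,x^2,\dots\}$; (LG4) $(Rx^m)(Rx^n)\subseteq R+Rx+\cdots+Rx^{m+n}$ for all $m,n\in\mathbb{N}$. Right GNOE of $R$: a pair $(S,x)$ satisfying (LG1), (LG2), and: $S$ is a free right $R$-module with basis $\{1,x,x^2,\dots\}$; $(x^mR)(x^nR)\subseteq R+xR+\cdots+x^{m+n}R$ for all $m,n\in\mathbb{N}$. A GNOE is a pair that is both a left and a right GNOE.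 Degrees: a nonzero $p\in S$ is uniquely $p=r_0+r_1x+\cdots+r_nx^n$ with $r_i\in R$, $r_n\ne0$ (left GNOE); put $\deg_l p=n$, $\operatorname{lc}_l(p)=r_n$. Likewise (right GNOE) $p=x^nr_n+\cdots+xr_1+r_0$ uniquely with $r_n\neq 0$; put $\deg_r p=n$, $\operatorname{lc}_r(p)=r_n$. Also $\deg_l 0=\deg_r 0=-\infty$, $\operatorname{lc}_l(0)=\operatorname{lc}_r(0)=0$ (with $-\infty$ plus anything equal to $-\infty$). Degree-additive elements: given $p_1,\dots,p_n\in S$, an element $s$ of the right ideal $\langle p_1,\dots,p_n\rangle_S$ is left degree-additive (with respect to $p_1,\dots,p_n$) if it has a representation $s=\sum_i\sum_j(\cdots((p_is_{ij1})s_{ij2})\cdots)s_{ijm}$ with $s_{ijk}\in S$, $1\le i\le n$, $1\le j,k\le m$, such that $\deg_l s=\max_i\bigl(\deg_l p_i+\max_j\sum_k\deg_l s_{ijk}\bigr)$. An element $s$ of the left ideal ${}_S\langle p_1,\dots,p_n\rangle$ is right degree-additive if it has a representation $s=\sum_i\sum_j s_{ijm}(\cdots(s_{ij2}(s_{ij1}p_i))\cdots)$ with $s_{ijk}\in S$ such that $\deg_r s=\max_i\bigl(\deg_r p_i+\max_j\sum_k\deg_r s_{ijk}\bigr)$. Left Euclidean division algorithm: for all $p_1,\dots,p_n\in S$ and nonzero $q\in S$ with $\deg_l q\ge\max_i\deg_l p_i$ and $\operatorname{lc}_l(q)\in\langle\operatorname{lc}_l(p_1),\dots,\operatorname{lc}_l(p_n)\rangle_R$,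 there exists a left degree-additive element $s$ of $\langle p_1,\dots,p_n\rangle_S$ such that $\deg_l(q-s)<\deg_l q$. Right Euclidean division algorithm: for all $p_1,\dots,p_n\in S$ and nonzero $q\in S$ with $\deg_r q\ge\max_i\deg_r p_i$ and $\operatorname{lc}_r(q)\in{}_R\langle\operatorname{lc}_r(p_1),\dots,\operatorname{lc}_r(p_n)\rangle$, there exists a right degree-additive element $s$ of ${}_S\langle p_1,\dots,p_n\rangle$ such that $\deg_r(q-s)<\deg_r q$. A GNOE satisfies the Euclidean division algorithm if it satisfies both. *)

theory Defs
  imports Complex_Main "HOL-Library.Extended_Real"
begin

class nonassoc_ring_1 = ab_group_add + power +
  assumes nonassoc_distrib_right: "(a + b) * c = a * c + b * c"
    and nonassoc_distrib_left: "a * (b + c) = a * b + a * c"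
    and nonassoc_one_left: "1 * a = a"
    and nonassoc_one_right: "a * 1 = a"

definition unital_subring :: "'s::nonassoc_ring_1 set \<Rightarrow> bool" where
  "unital_subring T \<longleftrightarrow>
     1 \<in> T \<and> (\<forall>a\<in>T. \<forall>b\<in>T. a - b \<in> T) \<and> (\<forall>a\<in>T. \<forall>b\<in>T. a * b \<in> T)"

definition additive_subgroup :: "'m::ab_group_add set \<Rightarrow> bool" where
  "additive_subgroup N \<longleftrightarrow> 0 \<in> N \<and> (\<forall>a\<in>N. \<forall>b\<in>N. a - b \<in> N)"

text \<open>Since modules over a nonassociative ring satisfy no associativity axiom, left and right
  modules are the same data: a biadditive action, written here as \<open>act r m\<close>. A ring is a left
  module over a subring via \<open>(*)\<close> and a right module via \<open>rmul\<close>.\<close>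

definition rmul :: "'s::nonassoc_ring_1 \<Rightarrow> 's \<Rightarrow> 's" where
  "rmul r s = s * r"

definition is_module ::
  "'r::nonassoc_ring_1 set \<Rightarrow> 'm::ab_group_add set \<Rightarrow> ('r \<Rightarrow> 'm \<Rightarrow> 'm) \<Rightarrow> bool" where
  "is_module R M act \<longleftrightarrow>
     unital_subring R \<and> additive_subgroup M \<and>
     (\<forall>r\<in>R. \<forall>m\<in>M. act r m \<in> M) \<and>
     (\<forall>r\<in>R. \<forall>r'\<in>R. \<forall>m\<in>M. act (r + r') m = act r m + act r' m) \<and>
     (\<forall>r\<in>R. \<forall>m\<in>M. \<forall>m'\<in>M. act r (m + m') = act r m + act r m')"

definition is_submodule ::
  "'r::nonassoc_ring_1 set \<Rightarrow> 'm::ab_group_add set \<Rightarrow> ('r \<Rightarrow> 'm \<Rightarrow> 'm) \<Rightarrow> 'm set \<Rightarrow> bool" where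
  "is_submodule R M act N \<longleftrightarrow>
     N \<subseteq> M \<and> additive_subgroup N \<and> (\<forall>r\<in>R. \<forall>m\<in>N. act r m \<in> N)"

definition generated_submodule ::
  "'r::nonassoc_ring_1 set \<Rightarrow> 'm::ab_group_add set \<Rightarrow> ('r \<Rightarrow> 'm \<Rightarrow> 'm) \<Rightarrow> 'm set \<Rightarrow> 'm set" where
  "generated_submodule R M act X = \<Inter>{N. is_submodule R M act N \<and> X \<subseteq> N}"

definition noetherian_module ::
  "'r::nonassoc_ring_1 set \<Rightarrow> 'm::ab_group_add set \<Rightarrow> ('r \<Rightarrow> 'm \<Rightarrow> 'm) \<Rightarrow> bool" where
  "noetherian_module R M act \<longleftrightarrow>
     is_module R M act \<and>
     (\<forall>N. is_submodule R M act N \<longrightarrow>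
        (\<exists>X\<subseteq>N. finite X \<and> N = generated_submodule R M act X))"

definition noetherian_ring :: "'s::nonassoc_ring_1 set \<Rightarrow> bool" where
  "noetherian_ring T \<longleftrightarrow> noetherian_module T T (*) \<and> noetherian_module T T rmul"

definition is_coords ::
  "'r::nonassoc_ring_1 set \<Rightarrow> ('r \<Rightarrow> 'm::ab_group_add \<Rightarrow> 'm) \<Rightarrow> ('i \<Rightarrow> 'm) \<Rightarrow> 'm \<Rightarrow> ('i \<Rightarrow> 'r) \<Rightarrow> bool"
  where
  "is_coords R act b v c \<longleftrightarrow>
     range c \<subseteq> R \<and> finite {i. c i \<noteq> 0} \<and> v = (\<Sum>i | c i \<noteq> 0. act (c i) (b i))"

definition is_free_module ::
  "'r::nonassoc_ring_1 set \<Rightarrow> 'm::ab_group_add set \<Rightarrow> ('r \<Rightarrow> 'm \<Rightarrow> 'm) \<Rightarrow> ('i \<Rightarrow> 'm) \<Rightarrow> bool" where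
  "is_free_module R M act b \<longleftrightarrow>
     is_module R M act \<and> range b \<subseteq> M \<and> (\<forall>v\<in>M. \<exists>!c. is_coords R act b v c)"

definition power_associative :: "'s::nonassoc_ring_1 \<Rightarrow> bool" where
  "power_associative x \<longleftrightarrow>
     (let T = \<Inter>{T. unital_subring T \<and> x \<in> T}
      in \<forall>a\<in>T. \<forall>b\<in>T. \<forall>c\<in>T. (a * b) * c = a * (b * c))"

text \<open>The extension ring \<open>S\<close> is the whole type \<open>'s\<close>, and \<open>R\<close> is a subset of it.
  Taking \<open>act = (*)\<close> gives terms \<open>r * x ^ n\<close> (the left notions),
  \<open>act = rmul\<close> gives terms \<open>x ^ n * r\<close> (the right notions).\<close>

definition one_sided_gnoe ::
  "('s \<Rightarrow> 's \<Rightarrow> 's) \<Rightarrow> 's::nonassoc_ring_1 set \<Rightarrow> 's \<Rightarrow> bool" where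
  "one_sided_gnoe act R x \<longleftrightarrow>
     unital_subring R \<and>
     power_associative x \<and>
     is_free_module R UNIV act (\<lambda>n::nat. x ^ n) \<and>
     (\<forall>m n. \<forall>r\<in>R. \<forall>t\<in>R. act r (x ^ m) * act t (x ^ n)
        \<in> {\<Sum>k\<le>m + n. act (c k) (x ^ k) | c. range c \<subseteq> R})"

definition left_gnoe :: "'s::nonassoc_ring_1 set \<Rightarrow> 's \<Rightarrow> bool" where
  "left_gnoe R x \<longleftrightarrow> one_sided_gnoe (*) R x"

definition right_gnoe :: "'s::nonassoc_ring_1 set \<Rightarrow> 's \<Rightarrow> bool" where
  "right_gnoe R x \<longleftrightarrow> one_sided_gnoe rmul R x"

definition gnoe :: "'s::nonassoc_ring_1 set \<Rightarrow> 's \<Rightarrow> bool" where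
  "gnoe R x \<longleftrightarrow> left_gnoe R x \<and> right_gnoe R x"

definition gnoe_coeff ::
  "('s \<Rightarrow> 's \<Rightarrow> 's) \<Rightarrow> 's::nonassoc_ring_1 set \<Rightarrow> 's \<Rightarrow> 's \<Rightarrow> nat \<Rightarrow> 's" where
  "gnoe_coeff act R x p = (THE c. is_coords R act (\<lambda>n. x ^ n) p c)"

definition top_index ::
  "('s \<Rightarrow> 's \<Rightarrow> 's) \<Rightarrow> 's::nonassoc_ring_1 set \<Rightarrow> 's \<Rightarrow> 's \<Rightarrow> nat" where
  "top_index act R x p = Max {n. gnoe_coeff act R x p n \<noteq> 0}"

definition deg ::
  "('s \<Rightarrow> 's \<Rightarrow> 's) \<Rightarrow> 's::nonassoc_ring_1 set \<Rightarrow> 's \<Rightarrow> 's \<Rightarrow> ereal" where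
  "deg act R x p = (if p = 0 then - \<infinity> else ereal (real (top_index act R x p)))"

definition lc ::
  "('s \<Rightarrow> 's \<Rightarrow> 's) \<Rightarrow> 's::nonassoc_ring_1 set \<Rightarrow> 's \<Rightarrow> 's \<Rightarrow> 's" where
  "lc act R x p = (if p = 0 then 0 else gnoe_coeff act R x p (top_index act R x p))"

abbreviation deg_l :: "'s::nonassoc_ring_1 set \<Rightarrow> 's \<Rightarrow> 's \<Rightarrow> ereal" where
  "deg_l \<equiv> deg (*)"

abbreviation deg_r :: "'s::nonassoc_ring_1 set \<Rightarrow> 's \<Rightarrow> 's \<Rightarrow> ereal" where
  "deg_r \<equiv> deg rmul"

abbreviation lc_l :: "'s::nonassoc_ring_1 set \<Rightarrow> 's \<Rightarrow> 's \<Rightarrow> 's" where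
  "lc_l \<equiv> lc (*)"

abbreviation lc_r :: "'s::nonassoc_ring_1 set \<Rightarrow> 's \<Rightarrow> 's \<Rightarrow> 's" where
  "lc_r \<equiv> lc rmul"

text \<open>Maxima of degrees are suprema in \<open>ereal\<close>, so that the maximum of the empty family
  (\<open>n = 0\<close>) is \<open>- \<infinity>\<close>. The left notions, measured by \<open>deg_l\<close>, concern \<^emph>\<open>right\<close> ideals, and
  vice versa.\<close>

definition left_degree_additive ::
  "'s::nonassoc_ring_1 set \<Rightarrow> 's \<Rightarrow> nat \<Rightarrow> (nat \<Rightarrow> 's) \<Rightarrow> 's \<Rightarrow> bool" where
  "left_degree_additive R x n p s \<longleftrightarrow>
     s \<in> generated_submodule UNIV UNIV rmul (p ` {1..n}) \<and>
     (\<exists>m\<ge>1. \<exists>t :: nat \<Rightarrow> nat \<Rightarrow> nat \<Rightarrow> 's.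
        s = (\<Sum>i=1..n. \<Sum>j=1..m. foldl (\<lambda>a u. a * u) (p i) (map (t i j) [1..<Suc m])) \<and>
        deg_l R x s =
          (SUP i\<in>{1..n}. deg_l R x (p i) + (SUP j\<in>{1..m}. \<Sum>k=1..m. deg_l R x (t i j k))))"

definition right_degree_additive ::
  "'s::nonassoc_ring_1 set \<Rightarrow> 's \<Rightarrow> nat \<Rightarrow> (nat \<Rightarrow> 's) \<Rightarrow> 's \<Rightarrow> bool" where
  "right_degree_additive R x n p s \<longleftrightarrow>
     s \<in> generated_submodule UNIV UNIV (*) (p ` {1..n}) \<and>
     (\<exists>m\<ge>1. \<exists>t :: nat \<Rightarrow> nat \<Rightarrow> nat \<Rightarrow> 's.
        s = (\<Sum>i=1..n. \<Sum>j=1..m. foldl (\<lambda>a u. u * a) (p i) (map (t i j) [1..<Suc m])) \<and>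
        deg_r R x s =
          (SUP i\<in>{1..n}. deg_r R x (p i) + (SUP j\<in>{1..m}. \<Sum>k=1..m. deg_r R x (t i j k))))"

definition left_euclidean_division :: "'s::nonassoc_ring_1 set \<Rightarrow> 's \<Rightarrow> bool" where
  "left_euclidean_division R x \<longleftrightarrow>
     (\<forall>n (p :: nat \<Rightarrow> 's) q. q \<noteq> 0 \<and>
        (SUP i\<in>{1..n}. deg_l R x (p i)) \<le> deg_l R x q \<and>
        lc_l R x q \<in> generated_submodule R R rmul ((\<lambda>i. lc_l R x (p i)) ` {1..n}) \<longrightarrow>
        (\<exists>s. left_degree_additive R x n p s \<and> deg_l R x (q - s) < deg_l R x q))"

definition right_euclidean_division :: "'s::nonassoc_ring_1 set \<Rightarrow> 's \<Rightarrow> bool" where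
  "right_euclidean_division R x \<longleftrightarrow>
     (\<forall>n (p :: nat \<Rightarrow> 's) q. q \<noteq> 0 \<and>
        (SUP i\<in>{1..n}. deg_r R x (p i)) \<le> deg_r R x q \<and>
        lc_r R x q \<in> generated_submodule R R (*) ((\<lambda>i. lc_r R x (p i)) ` {1..n}) \<longrightarrow>
        (\<exists>s. right_degree_additive R x n p s \<and> deg_r R x (q - s) < deg_r R x q))"

definition euclidean_division :: "'s::nonassoc_ring_1 set \<Rightarrow> 's \<Rightarrow> bool" where
  "euclidean_division R x \<longleftrightarrow> left_euclidean_division R x \<and> right_euclidean_division R x"

end

theory Submission
  imports Defs
begin

text \<open>
  The proof is Hilbert's argument for his basis theorem, in the form that never adds or multiplies
  leading coefficients: it only compares the leading coefficient of one element with the ideal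
  generated by those of others. That suits the nonassociative setting, where the leading
  coefficients of the elements of an ideal need not themselves form an ideal.

  If a right ideal \<open>I\<close> of \<open>S\<close> were not finitely generated, there would be an endless sequence
  \<open>f 0, f 1, \<dots>\<close> in \<open>I\<close> in which each \<open>f n\<close> has least degree among the elements of \<open>I\<close> outside the
  right ideal generated by its predecessors. The degrees in this sequence increase weakly. The
  leading coefficients generate a right ideal of \<open>R\<close>, and since \<open>R\<close> is right Noetherian, finitely
  many of them already generate it; so for some \<open>n\<close> the leading coefficient of \<open>f n\<close> lies in the
  right ideal generated by those of its predecessors. Euclidean division then gives \<open>s\<close> in the
  right ideal generated by the predecessors such that \<open>f n - s\<close> has smaller degree than \<open>f n\<close>. But
  \<open>f n - s\<close> is still in \<open>I\<close> and outside that right ideal, against the choice of \<open>f n\<close>.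

  The lemma \<open>noetherian_if_division\<close> is this argument for any module whose elements
  carry a degree and a leading coefficient. It covers both sides, because right ideals are the
  submodules for \<open>rmul\<close> and left ideals those for \<open>(*)\<close>. Its supply of finitely many leading
  coefficients comes from \<open>noetherian_finite_subset_generates\<close>.
\<close>

lemma is_submodule_self:
  "is_module R M act \<Longrightarrow> is_submodule R M act M"
  by (auto simp: is_module_def is_submodule_def)

lemma generated_submodule_subset:
  "X \<subseteq> generated_submodule R M act X"
  by (auto simp: generated_submodule_def)

lemma generated_submodule_least:
  "is_submodule R M act N \<Longrightarrow> X \<subseteq> N \<Longrightarrow> generated_submodule R M act X \<subseteq> N"
  by (auto simp: generated_submodule_def)

lemma generated_submodule_mono:
  "X \<subseteq> Y \<Longrightarrow> generated_submodule R M act X \<subseteq> generated_submodule R M act Y"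
  by (auto simp: generated_submodule_def)

lemma is_submodule_generated:
  assumes "is_module R M act" "X \<subseteq> M"
  shows "is_submodule R M act (generated_submodule R M act X)"
proof -
  have "generated_submodule R M act X \<subseteq> M"
    using assms by (intro generated_submodule_least is_submodule_self)
  then show ?thesis
    unfolding is_submodule_def additive_subgroup_def
    by (auto simp: generated_submodule_def is_submodule_def additive_subgroup_def)
qed

lemma additive_subgroup_diff_cancel:
  assumes "additive_subgroup N" "a - s \<in> N" "s \<in> N"
  shows "a \<in> N"
proof -
  have "0 - s \<in> N"
    using assms unfolding additive_subgroup_def by blast
  then have "(a - s) - (0 - s) \<in> N"
    using assms unfolding additive_subgroup_def by blast
  then show ?thesis by simp
qed

text \<open>The submodules generated by the finite subsets of \<open>X\<close> are directed, so their union is a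
  submodule, namely the one that \<open>X\<close> generates. A finite set of generators taken from this union
  involves only finitely many of those finite subsets.\<close>

lemma noetherian_finite_subset_generates:
  assumes noeth: "noetherian_module R M act" and X: "X \<subseteq> M"
  obtains Y where "finite Y" "Y \<subseteq> X"
    "generated_submodule R M act Y = generated_submodule R M act X"
proof -
  let ?gen = "generated_submodule R M act"
  have mod: "is_module R M act"
    using noeth by (simp add: noetherian_module_def)
  define U where "U = (\<Union>Y\<in>{Y. finite Y \<and> Y \<subseteq> X}. ?gen Y)"
  have sub: "is_submodule R M act (?gen Y)" if "Y \<subseteq> X" for Y
    using mod that X by (blast intro: is_submodule_generated)
  have "is_submodule R M act U"
    unfolding is_submodule_def additive_subgroup_def
  proof (intro conjI ballI)
    show "U \<subseteq> M"
      using sub unfolding U_def is_submodule_def by blast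
    have "0 \<in> ?gen {}"
      using sub[of "{}"] by (simp add: is_submodule_def additive_subgroup_def)
    then show "0 \<in> U"
      unfolding U_def by blast
  next
    fix a b assume "a \<in> U" "b \<in> U"
    then obtain Y Z where YZ: "finite Y" "Y \<subseteq> X" "a \<in> ?gen Y" "finite Z" "Z \<subseteq> X" "b \<in> ?gen Z"
      unfolding U_def by blast
    then have "a \<in> ?gen (Y \<union> Z)" "b \<in> ?gen (Y \<union> Z)"
      using generated_submodule_mono[of Y "Y \<union> Z"] generated_submodule_mono[of Z "Y \<union> Z"]
      by blast+
    then have "a - b \<in> ?gen (Y \<union> Z)"
      using sub[of "Y \<union> Z"] YZ unfolding is_submodule_def additive_subgroup_def by blast
    then show "a - b \<in> U"
      unfolding U_def using YZ by blast
  next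
    fix r m assume "r \<in> R" "m \<in> U"
    then show "act r m \<in> U"
      using sub unfolding U_def is_submodule_def by blast
  qed
  moreover have "X \<subseteq> U"
  proof
    fix a assume "a \<in> X"
    moreover have "a \<in> ?gen {a}"
      using generated_submodule_subset[of "{a}"] by blast
    ultimately show "a \<in> U"
      unfolding U_def by blast
  qed
  ultimately have gen_le: "?gen X \<subseteq> U"
    by (rule generated_submodule_least)
  obtain Z where Z: "finite Z" "Z \<subseteq> ?gen X" "?gen X = ?gen Z"
    using noeth sub[of X] unfolding noetherian_module_def by blast
  have "\<forall>z\<in>Z. \<exists>Y. finite Y \<and> Y \<subseteq> X \<and> z \<in> ?gen Y"
    using Z(2) gen_le unfolding U_def by blast
  then obtain F where F: "\<forall>z\<in>Z. finite (F z) \<and> F z \<subseteq> X \<and> z \<in> ?gen (F z)"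
    by metis
  let ?Y = "\<Union>z\<in>Z. F z"
  have Y: "finite ?Y" "?Y \<subseteq> X"
    using F Z(1) by auto
  have "Z \<subseteq> ?gen ?Y"
  proof
    fix z assume z: "z \<in> Z"
    then have "?gen (F z) \<subseteq> ?gen ?Y"
      by (intro generated_submodule_mono) blast
    then show "z \<in> ?gen ?Y"
      using F z by blast
  qed
  then have "?gen X \<subseteq> ?gen ?Y"
    using sub[OF Y(2)] Z(3) generated_submodule_least by blast
  then show thesis
    using that[OF Y] generated_submodule_mono[OF Y(2)] by blast
qed

text \<open>Here \<open>d\<close> is the degree and \<open>l\<close> the leading coefficient, with values in a module \<open>K\<close> over
  another ring. What ties them to the module structure is one step of division with remainder: if \<open>q\<close> has
  at least the degree of every element of a finite set \<open>F\<close>, and its leading coefficient is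
  generated by those of \<open>F\<close>, then its degree can be lowered modulo \<open>F\<close>. The premise \<open>q \<noteq> s\<close> is
  there because \<open>d\<close> is a natural number and cannot be \<open>- \<infinity>\<close> at \<open>0\<close>.\<close>

lemma noetherian_if_division:
  fixes d :: "'m::ab_group_add \<Rightarrow> nat"
  assumes mod: "is_module A M act"
    and noeth: "noetherian_module R K act'"
    and l: "\<And>p. p \<in> M \<Longrightarrow> p \<noteq> 0 \<Longrightarrow> l p \<in> K"
    and division: "\<And>F q. finite F \<Longrightarrow> F \<subseteq> M - {0} \<Longrightarrow> q \<in> M - {0} \<Longrightarrow> \<forall>p\<in>F. d p \<le> d q \<Longrightarrow>
      l q \<in> generated_submodule R K act' (l ` F) \<Longrightarrow>
      \<exists>s\<in>generated_submodule A M act F. q \<noteq> s \<longrightarrow> d (q - s) < d q"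
  shows "noetherian_module A M act"
proof (rule ccontr)
  let ?gen = "generated_submodule A M act"
  let ?genK = "generated_submodule R K act'"
  assume "\<not> noetherian_module A M act"
  then obtain I where I: "is_submodule A M act I"
    and not_fg: "\<And>X. X \<subseteq> I \<Longrightarrow> finite X \<Longrightarrow> I \<noteq> ?gen X"
    using mod unfolding noetherian_module_def by blast
  have IM: "I \<subseteq> M"
    using I by (simp add: is_submodule_def)
  define minimal where "minimal J p \<longleftrightarrow> p \<in> I - J \<and> (\<forall>q\<in>I - J. d p \<le> d q)" for J p
  have "\<exists>f. \<forall>n::nat. minimal (?gen (f ` {..<n})) (f n)"
  proof (rule dependent_wf_choice[OF wf_less_than])
    fix f :: "nat \<Rightarrow> 'm" and n
    assume "\<And>k. (k, n) \<in> less_than \<Longrightarrow> minimal (?gen (f ` {..<k})) (f k)"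
    then have sub: "f ` {..<n} \<subseteq> I"
      by (auto simp: minimal_def)
    then have "?gen (f ` {..<n}) \<subseteq> I" "I \<noteq> ?gen (f ` {..<n})"
      using generated_submodule_least[OF I sub] not_fg[OF sub] by auto
    then have "\<exists>p. p \<in> I - ?gen (f ` {..<n})"
      by blast
    then show "\<exists>p. minimal (?gen (f ` {..<n})) p"
      unfolding minimal_def using ex_has_least_nat[of "\<lambda>p. p \<in> I - ?gen (f ` {..<n})" _ d]
      by blast
  next
    fix f g :: "nat \<Rightarrow> 'm" and n p
    assume "\<And>k. (k, n) \<in> less_than \<Longrightarrow> f k = g k"
    then have "f ` {..<n} = g ` {..<n}"
      by (intro image_cong) auto
    then show "minimal (?gen (f ` {..<n})) p = minimal (?gen (g ` {..<n})) p"
      by simp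
  qed
  then obtain f where f: "minimal (?gen (f ` {..<n})) (f n)" for n :: nat
    by blast
  have fI: "f n \<in> I" and f_new: "f n \<notin> ?gen (f ` {..<n})" for n
    using f by (auto simp: minimal_def)
  have fM: "range f \<subseteq> M"
    using fI IM by blast
  have sub: "is_submodule A M act (?gen (f ` {..<n}))" for n
    using mod fM by (intro is_submodule_generated) auto
  have f_nonzero: "f n \<noteq> 0" for n
    using f_new[of n] sub[of n] by (auto simp: is_submodule_def additive_subgroup_def)
  have lf: "range (l \<circ> f) \<subseteq> K"
    using l fM f_nonzero by auto
  obtain Y where Y: "finite Y" "Y \<subseteq> range (l \<circ> f)" "?genK Y = ?genK (range (l \<circ> f))"
    using noetherian_finite_subset_generates[OF noeth lf] by blast
  obtain T where T: "finite T" "Y = (l \<circ> f) ` T"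
    using finite_subset_image[OF Y(1,2)] by auto
  obtain n where "T \<subseteq> {..<n}"
    using T(1) finite_nat_bounded by blast
  then have "?genK Y \<subseteq> ?genK (l ` f ` {..<n})"
    unfolding T(2) by (intro generated_submodule_mono) auto
  moreover have "l (f n) \<in> ?genK Y"
    using Y(3) generated_submodule_subset[of "range (l \<circ> f)" R K act'] by auto
  ultimately have lfn: "l (f n) \<in> ?genK (l ` f ` {..<n})"
    by blast
  \<comment> \<open>An earlier element was chosen as minimal among candidates that included \<open>f n\<close>.\<close>
  have d_mono: "d (f i) \<le> d (f n)" if "i < n" for i
  proof -
    have "?gen (f ` {..<i}) \<subseteq> ?gen (f ` {..<n})"
      using that by (intro generated_submodule_mono) auto
    then have "f n \<in> I - ?gen (f ` {..<i})"
      using fI f_new by blast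
    then show ?thesis
      using f[of i] by (simp add: minimal_def)
  qed
  have "\<exists>s\<in>?gen (f ` {..<n}). f n \<noteq> s \<longrightarrow> d (f n - s) < d (f n)"
  proof (rule division[OF _ _ _ _ lfn])
    show "f ` {..<n} \<subseteq> M - {0}" "f n \<in> M - {0}"
      using fM f_nonzero by auto
  qed (use d_mono in auto)
  then obtain s where s: "s \<in> ?gen (f ` {..<n})" "f n \<noteq> s \<longrightarrow> d (f n - s) < d (f n)"
    by blast
  have "f n \<noteq> s"
    using s(1) f_new by blast
  moreover have "f n - s \<notin> ?gen (f ` {..<n})"
    using additive_subgroup_diff_cancel s(1) sub f_new unfolding is_submodule_def by blast
  moreover have "f n - s \<in> I"
  proof -
    have "?gen (f ` {..<n}) \<subseteq> I"
      using I fI by (intro generated_submodule_least) auto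
    then show ?thesis
      using s(1) I fI unfolding is_submodule_def additive_subgroup_def by blast
  qed
  ultimately show False
    using s(2) f[of n] unfolding minimal_def by (meson DiffI not_le)
qed

lemma lc_in_coefficients:
  assumes "one_sided_gnoe act R x"
  shows "lc act R x p \<in> R"
proof (cases "p = 0")
  case True
  have "1 - 1 \<in> R"
    using assms unfolding one_sided_gnoe_def unital_subring_def by blast
  then show ?thesis
    using True by (simp add: lc_def)
next
  case False
  have "\<exists>!c. is_coords R act (\<lambda>n. x ^ n) p c"
    using assms by (simp add: one_sided_gnoe_def is_free_module_def)
  then have "is_coords R act (\<lambda>n. x ^ n) p (gnoe_coeff act R x p)"
    unfolding gnoe_coeff_def by (rule theI')
  then show ?thesis
    using False by (auto simp: is_coords_def lc_def)
qed

lemma deg_le_iff: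
  "p \<noteq> 0 \<Longrightarrow> q \<noteq> 0 \<Longrightarrow> deg act R x p \<le> deg act R x q \<longleftrightarrow> top_index act R x p \<le> top_index act R x q"
  by (simp add: deg_def)

lemma deg_less_iff:
  "p \<noteq> 0 \<Longrightarrow> q \<noteq> 0 \<Longrightarrow> deg act R x p < deg act R x q \<longleftrightarrow> top_index act R x p < top_index act R x q"
  by (simp add: deg_def)

text \<open>The action \<open>act\<close> makes \<open>S\<close> a module over \<open>R\<close> and thereby fixes degrees and leading
  coefficients, whereas \<open>mult\<close> decides on which side ideals are formed; the two are
  opposite, since left degrees serve right ideals and right degrees serve left ideals.\<close>

lemma noetherian_extension_one_sided:
  fixes R :: "'s::nonassoc_ring_1 set"
  assumes gnoe: "one_sided_gnoe act R x"
    and mod: "is_module (UNIV :: 's set) (UNIV :: 's set) mult"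
    and noeth: "noetherian_module R R mult"
    and division: "\<And>n (p :: nat \<Rightarrow> 's) q. q \<noteq> 0 \<Longrightarrow>
      (SUP i\<in>{1..n}. deg act R x (p i)) \<le> deg act R x q \<Longrightarrow>
      lc act R x q \<in> generated_submodule R R mult ((\<lambda>i. lc act R x (p i)) ` {1..n}) \<Longrightarrow>
      \<exists>s\<in>generated_submodule UNIV UNIV mult (p ` {1..n}). deg act R x (q - s) < deg act R x q"
  shows "noetherian_module (UNIV :: 's set) (UNIV :: 's set) mult"
proof (rule noetherian_if_division[OF mod noeth])
  show "lc act R x p \<in> R" for p
    using gnoe by (rule lc_in_coefficients)
next
  fix F q
  assume F: "finite F" "F \<subseteq> UNIV - {0}" and q: "q \<in> UNIV - {0}"
    and le: "\<forall>p\<in>F. top_index act R x p \<le> top_index act R x q"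
    and lc: "lc act R x q \<in> generated_submodule R R mult (lc act R x ` F)"
  obtain p :: "nat \<Rightarrow> 's" where "bij_betw p {1..card F} F"
    using ex_bij_betw_nat_finite_1[OF F(1)] by blast
  then have p: "p ` {1..card F} = F"
    by (rule bij_betw_imp_surj_on)
  have "(SUP i\<in>{1..card F}. deg act R x (p i)) \<le> deg act R x q"
  proof (rule SUP_least)
    fix i assume "i \<in> {1..card F}"
    then have "p i \<in> F"
      using p by blast
    then show "deg act R x (p i) \<le> deg act R x q"
      using F q le by (subst deg_le_iff) auto
  qed
  moreover have "(\<lambda>i. lc act R x (p i)) ` {1..card F} = lc act R x ` F"
    using p by (metis image_image)
  ultimately obtain s where "s \<in> generated_submodule UNIV UNIV mult F"
    "deg act R x (q - s) < deg act R x q"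
    using division[of q p "card F"] q lc p by auto
  then show "\<exists>s\<in>generated_submodule UNIV UNIV mult F.
      q \<noteq> s \<longrightarrow> top_index act R x (q - s) < top_index act R x q"
    using q deg_less_iff[of "q - _" q act R x] by auto
qed

lemma is_module_regular_left:
  "is_module (UNIV :: 's::nonassoc_ring_1 set) (UNIV :: 's set) (*)"
  by (simp add: is_module_def unital_subring_def additive_subgroup_def
      nonassoc_distrib_left nonassoc_distrib_right)

lemma is_module_regular_right:
  "is_module (UNIV :: 's::nonassoc_ring_1 set) (UNIV :: 's set) rmul"
  by (simp add: is_module_def unital_subring_def additive_subgroup_def rmul_def
      nonassoc_distrib_left nonassoc_distrib_right)

theorem theorem3:
  fixes R :: "'s::nonassoc_ring_1 set" and x :: 's
  assumes "gnoe R x"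
    and "euclidean_division R x"
    and "noetherian_ring R"
  shows "noetherian_ring (UNIV :: 's set)"
  unfolding noetherian_ring_def
proof
  have gnoe: "one_sided_gnoe rmul R x" and noeth: "noetherian_module R R (*)"
    and division: "right_euclidean_division R x"
    using assms by (auto simp: gnoe_def right_gnoe_def noetherian_ring_def euclidean_division_def)
  show "noetherian_module (UNIV :: 's set) UNIV (*)"
  proof (rule noetherian_extension_one_sided[OF gnoe is_module_regular_left noeth])
    fix n q and p :: "nat \<Rightarrow> 's"
    assume "q \<noteq> 0" "(SUP i\<in>{1..n}. deg_r R x (p i)) \<le> deg_r R x q"
      "lc_r R x q \<in> generated_submodule R R (*) ((\<lambda>i. lc_r R x (p i)) ` {1..n})"
    then obtain s where "right_degree_additive R x n p s" "deg_r R x (q - s) < deg_r R x q"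
      using division unfolding right_euclidean_division_def by blast
    then show "\<exists>s\<in>generated_submodule UNIV UNIV (*) (p ` {1..n}). deg_r R x (q - s) < deg_r R x q"
      unfolding right_degree_additive_def by blast
  qed
next
  have gnoe: "one_sided_gnoe (*) R x" and noeth: "noetherian_module R R rmul"
    and division: "left_euclidean_division R x"
    using assms by (auto simp: gnoe_def left_gnoe_def noetherian_ring_def euclidean_division_def)
  show "noetherian_module (UNIV :: 's set) UNIV rmul"
  proof (rule noetherian_extension_one_sided[OF gnoe is_module_regular_right noeth])
    fix n q and p :: "nat \<Rightarrow> 's"
    assume "q \<noteq> 0" "(SUP i\<in>{1..n}. deg_l R x (p i)) \<le> deg_l R x q"
      "lc_l R x q \<in> generated_submodule R R rmul ((\<lambda>i. lc_l R x (p i)) ` {1..n})"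
    then obtain s where "left_degree_additive R x n p s" "deg_l R x (q - s) < deg_l R x q"
      using division unfolding left_euclidean_division_def by blast
    then show "\<exists>s\<in>generated_submodule UNIV UNIV rmul (p ` {1..n}). deg_l R x (q - s) < deg_l R x q"
      unfolding left_degree_additive_def by blast
  qed
qed

end
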